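(* Let $x, y, z$ be positive integers with $y$ prime. Then $$2^x = \frac{y^z-1}{y-1}$$ holds if and only if $z = 2$, $x$ is a prime number, and $y = 2^x - 1$ (so that $y$ is a Mersenne prime). *)

theory Defs
  imports Complex_Main "HOL-Computational_Algebra.Primes"
begin

end

theory Submission
  imports Defs
begin

text \<open>
  The quotient is the geometric sum \<open>1 + y + \<dots> + y^(z - 1)\<close>. If it is a power of two
  other than 1, then \<open>y\<close> is odd and \<open>z = 2 * k\<close> is even, and the sum factors as
  \<open>(1 + y) * (\<Sum>i<k. (y^2)^i)\<close>. If \<open>k > 1\<close>, the second factor is again a nontrivial power of
  two, so \<open>k\<close> is even and \<open>1 + y^2\<close> divides it by the same factorisation; but
  \<open>1 + y^2\<close> is congruent to 2 modulo 4 and exceeds 2. Hence \<open>k = 1\<close> and \<open>y = 2^x - 1\<close>.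
\<close>

text \<open>Consecutive terms pair up: \<open>y ^ (2 * i) + y ^ (2 * i + 1)\<close> is
  \<open>(1 + y) * y ^ (2 * i)\<close>. It is applied at base \<open>y\<close> and then at base
  \<open>y\<^sup>2\<close>.\<close>

lemma geometric_sum_even_length:
  fixes y :: "'a::comm_semiring_1"
  shows "(\<Sum>i<2 * k. y ^ i) = (1 + y) * (\<Sum>i<k. (y\<^sup>2) ^ i)"
  by (induction k) (simp_all add: algebra_simps flip: power_mult)

text \<open>All \<open>n\<close> terms are odd, so the sum has the parity of
  \<open>n\<close>.\<close>

lemma even_geometric_sum_iff:
  fixes y :: nat
  assumes "odd y"
  shows "even (\<Sum>i<n. y ^ i) \<longleftrightarrow> even n"
  using assms by (induction n) auto

lemma even_if_dvd_two_power:
  fixes d :: nat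
  assumes "d dvd 2 ^ x" "d > 1"
  shows "even d"
  using assms by (metis divides_primepow_nat dvd_refl even_power less_irrefl power_0 two_is_prime_nat gr0I)

lemma odd_square_Suc_not_dvd_two_power:
  fixes y :: nat
  assumes "odd y" "y > 1"
  shows "\<not> (1 + y\<^sup>2) dvd 2 ^ x"
proof
  assume dvd: "(1 + y\<^sup>2) dvd 2 ^ x"
  obtain m where m: "y = 2 * m + 1" using assms(1) by (auto elim: oddE)
  \<comment> \<open>The cofactor of 2 is odd, and it exceeds 1 since \<open>m > 0\<close>, so it
    cannot divide a power of two.\<close>
  have eq: "1 + y\<^sup>2 = 2 * (2 * m\<^sup>2 + 2 * m + 1)"
    by (simp add: m power2_eq_square algebra_simps)
  have "(2 * m\<^sup>2 + 2 * m + 1) dvd 2 ^ x"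
    using dvd unfolding eq by (rule dvd_mult_right)
  moreover have "m > 0" using assms(2) m by simp
  ultimately have "even (2 * m\<^sup>2 + 2 * m + 1)"
    by (intro even_if_dvd_two_power) auto
  then show False by simp
qed

lemma geometric_sum_eq_two_power:
  fixes y :: nat
  assumes eq: "(\<Sum>i<z. y ^ i) = 2 ^ x" and "x > 0" "y > 1"
  shows "z = 2 \<and> 1 + y = 2 ^ x"
proof -
  have "z \<noteq> 0" using eq by (intro notI) simp
  then obtain n where n: "z = Suc n" by (cases z) auto
  have even_sum: "even (\<Sum>i<z. y ^ i)" using eq \<open>x > 0\<close> by simp
  have "odd y"
  proof
    \<comment> \<open>Every term but the leading 1 would be even, making the sum odd.\<close>
    assume "even y"
    then have "even (\<Sum>i<n. y ^ Suc i)" by (intro dvd_sum) simp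
    moreover have "(\<Sum>i<z. y ^ i) = 1 + (\<Sum>i<n. y ^ Suc i)"
      unfolding n by (subst sum.lessThan_Suc_shift) simp
    ultimately show False using even_sum by simp
  qed
  then obtain k where k: "z = 2 * k"
    using even_sum even_geometric_sum_iff by blast
  let ?S = "\<Sum>i<k. (y\<^sup>2) ^ i"
  have fact: "(1 + y) * ?S = 2 ^ x"
    using eq unfolding k geometric_sum_even_length .
  have "k = 1"
  proof (rule ccontr)
    assume "k \<noteq> 1"
    \<comment> \<open>With \<open>k\<close> at least 2, two positive terms can be split off, which
      gives \<open>?S > 1\<close>.\<close>
    with k \<open>z \<noteq> 0\<close> obtain j where j: "k = Suc (Suc j)"
      by (metis One_nat_def mult_0_right not0_implies_Suc)
    have S_dvd: "?S dvd 2 ^ x" using fact by (metis dvd_triv_right)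
    have "(y\<^sup>2) ^ j > 0" "(y\<^sup>2) ^ Suc j > 0" using \<open>y > 1\<close> by simp_all
    moreover have "?S = (\<Sum>i<j. (y\<^sup>2) ^ i) + (y\<^sup>2) ^ j + (y\<^sup>2) ^ Suc j"
      unfolding j by (simp only: sum.lessThan_Suc)
    ultimately have "?S > 1" by linarith
    with S_dvd have "even ?S" by (rule even_if_dvd_two_power)
    then have "even k" using even_geometric_sum_iff[of "y\<^sup>2"] \<open>odd y\<close> by simp
    then obtain l where "k = 2 * l" by blast
    then have "(1 + y\<^sup>2) dvd ?S"
      by (simp only: geometric_sum_even_length dvd_triv_left)
    with S_dvd have "(1 + y\<^sup>2) dvd 2 ^ x" by (rule dvd_trans[rotated])
    then show False using odd_square_Suc_not_dvd_two_power \<open>odd y\<close> \<open>y > 1\<close> by blast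
  qed
  with fact k show ?thesis by simp
qed

text \<open>If \<open>a\<close> divides \<open>x\<close>, then \<open>2 ^ a - 1\<close> divides the
  prime \<open>2 ^ x - 1\<close>, so it is 1 or that prime; injectivity of \<open>2 ^ c - 1\<close>
  in \<open>c\<close> then determines \<open>a\<close>.\<close>

lemma mersenne_prime_exponent:
  assumes prime: "prime (2 ^ x - 1 :: nat)"
  shows "prime x"
  unfolding prime_nat_iff
proof (intro conjI allI impI)
  have "x \<noteq> 0" "x \<noteq> 1" using prime by (intro notI; simp)+
  then show "1 < x" by simp
next
  fix a assume "a dvd x"
  then obtain b where b: "x = a * b" by blast
  have inj: "c = d" if "2 ^ c - 1 = (2 ^ d - 1 :: nat)" for c d :: nat
  proof -
    have "(2::nat) ^ c = 2 ^ d"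
      using that by (metis Suc_diff_1 pos2 zero_less_power)
    then show ?thesis by simp
  qed
  \<comment> \<open>The factorisation of \<open>(2 ^ a) ^ b - 1\<close> is taken in the integers,
    where subtraction is not truncated.\<close>
  have "int (2 ^ a - 1) dvd int (2 ^ x - 1)"
    using power_diff_1_eq[of "2 ^ a :: int" b]
    by (simp add: b power_mult of_nat_diff)
  then have "(2 ^ a - 1 :: nat) dvd 2 ^ x - 1" by (simp only: int_dvd_int_iff)
  \<comment> \<open>The divisor 1 is written as \<open>2 ^ 1 - 1\<close> so that \<open>inj\<close>
    applies to both cases.\<close>
  with prime have "2 ^ a - 1 = (2 ^ 1 - 1 :: nat) \<or> 2 ^ a - 1 = (2 ^ x - 1 :: nat)"
    by (simp add: prime_nat_iff)
  then show "a = 1 \<or> a = x" using inj by blast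
qed

theorem mainTheorem5:
  fixes x y z :: nat
  assumes "x > 0" and "y > 0" and "z > 0" and "prime y"
  shows "(2::real) ^ x = (real y ^ z - 1) / (real y - 1) \<longleftrightarrow>
         z = 2 \<and> prime x \<and> int y = 2 ^ x - 1"
proof -
  have "y > 1" using \<open>prime y\<close> by (rule prime_gt_1_nat)
  \<comment> \<open>Since \<open>y > 1\<close>, the denominator is nonzero and the real equation
    becomes one between naturals.\<close>
  then have "(real y ^ z - 1) / (real y - 1) = real (\<Sum>i<z. y ^ i)"
    by (simp add: geometric_sum)
  then have "(2::real) ^ x = (real y ^ z - 1) / (real y - 1) \<longleftrightarrow>
      real (\<Sum>i<z. y ^ i) = real (2 ^ x)"
    by auto
  then have sum_iff: "(2::real) ^ x = (real y ^ z - 1) / (real y - 1) \<longleftrightarrow>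
      (\<Sum>i<z. y ^ i) = 2 ^ x"
    by (simp only: of_nat_eq_iff)
  have int_iff: "int y = 2 ^ x - 1 \<longleftrightarrow> 1 + y = 2 ^ x"
  proof -
    have "int y = 2 ^ x - 1 \<longleftrightarrow> int (1 + y) = int (2 ^ x)" by auto
    then show ?thesis by (simp only: of_nat_eq_iff)
  qed
  have "z = 2 \<and> prime x \<and> 1 + y = 2 ^ x" if "(\<Sum>i<z. y ^ i) = 2 ^ x"
  proof -
    have z: "z = 2" and y: "1 + y = 2 ^ x"
      using geometric_sum_eq_two_power[OF that \<open>x > 0\<close> \<open>y > 1\<close>] by auto
    have "y = 2 ^ x - 1" using y by simp
    with \<open>prime y\<close> have "prime x" using mersenne_prime_exponent by blast
    with z y show ?thesis by blast
  qed
  moreover have "(\<Sum>i<z. y ^ i) = 2 ^ x" if "z = 2" "1 + y = 2 ^ x"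
    using that by (simp add: numeral_2_eq_2)
  ultimately show ?thesis unfolding sum_iff int_iff by blast
qed

end
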